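(* Let $p$ be a prime with $p\equiv 2$ or $3\pmod 5$ and let $r$ be a positive integer. For $1\le i\le r$ let $$D_i=\left\{\left\langle\begin{pmatrix}0_{2\times(2r-2i)} & I_2 & A\end{pmatrix}\right\rangle : A\in\phi_O(\mathbb{F}_{p^2}^i)\right\},$$ that is, the set of subspaces of $\mathbb{F}_p^{2r+2}$ obtained from the members of the lift $\Lambda(\phi_O(\mathbb{F}_{p^2}^i))$ by appending zeros on the left of their vectors so that they have length $2r+2$. Let $\widehat H_2=(0_{2\times 2r}\ \ I_2)$. Then $$G_p(r,2)=\left\{\langle\widehat H_2\rangle\right\}\cup\bigcup_{i=1}^r D_i$$ is a $\left(2r+2,\ \dfrac{p^{2r+2}-1}{p^2-1},\ 4,\ 2\right)_p$ code.
   Context: Fix $\omega \in \mathbb{F}_{p^2}$ such that $\{1,\omega\}$ is an $\mathbb{F}_p$-basis of $\mathbb{F}_{p^2}$. For each positive integer $i$ the map $\phi_O:\mathbb{F}_{p^2}^i\to M_{2\times 2i}(\mathbb{F}_p)$ is defined, for $c_j,d_j\in\mathbb{F}_p$, by $$\phi_O((c_1+d_1\omega,\dots,c_i+d_i\omega))=\begin{pmatrix} d_1&c_1&d_2&c_2&\cdots&d_i&c_i\\ c_1+d_1&d_1&c_2+d_2&d_2&\cdots&c_i+d_i&d_i\end{pmatrix}.$$ $\langle M\rangle$ denotes the row space of a matrix $M$, $I_2$ is the $2\times2$ identity and $0_{a\times b}$ the $a\times b$ zero matrix. The lift of a set $\mathcal{C}\subseteq M_{k\times\ell}(\mathbb{F}_q)$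 is $\Lambda(\mathcal{C})=\{\langle (I_k\ A)\rangle : A\in\mathcal{C}\}$. The subspace distance is $d_S(U,V)=\dim U+\dim V-2\dim(U\cap V)$. An $(n,M,d,k)_q$ code is a set of $M$ $k$-dimensional subspaces of $\mathbb{F}_q^n$ whose minimum subspace distance between distinct members is $d$. *)

theory Defs
  imports
    "Berlekamp_Zassenhaus.Finite_Field"
    "Jordan_Normal_Form.VS_Connect"
begin

definition row_sp :: "'a::field mat \<Rightarrow> 'a vec set" where
  "row_sp A = vec_space.row_space (dim_col A) A"

definition sdim :: "nat \<Rightarrow> 'a::field vec set \<Rightarrow> nat" where
  "sdim n U = vectorspace.dim class_ring ((module_vec TYPE('a) n)\<lparr>carrier := U\<rparr>)"

definition subspace_dist :: "nat \<Rightarrow> 'a::field vec set \<Rightarrow> 'a vec set \<Rightarrow> int" where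
  "subspace_dist n U V = int (sdim n U) + int (sdim n V) - 2 * int (sdim n (U \<inter> V))"

text \<open>The last two conjuncts say that the minimum over distinct members exists and equals \<open>d\<close>.\<close>

definition subspace_code ::
    "nat \<Rightarrow> nat \<Rightarrow> nat \<Rightarrow> nat \<Rightarrow> nat \<Rightarrow> 'a::{field,finite} vec set set \<Rightarrow> bool" where
  "subspace_code q n M d k C \<longleftrightarrow>
     CARD('a) = q \<and>
     (\<forall>U\<in>C. VectorSpace.subspace class_ring U (module_vec TYPE('a) n) \<and> sdim n U = k) \<and>
     finite C \<and> card C = M \<and>
     (\<exists>U\<in>C. \<exists>V\<in>C. U \<noteq> V \<and> subspace_dist n U V = int d) \<and>
     (\<forall>U\<in>C. \<forall>V\<in>C. U \<noteq> V \<longrightarrow> int d \<le> subspace_dist n U V)"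

text \<open>Scalar multiplication of the prime field on a field of the same characteristic.
  It is meaningful only if the characteristics agree; see the lemma below.\<close>

definition fp_scale :: "'p::prime_card mod_ring \<Rightarrow> 'k::field \<Rightarrow> 'k" where
  "fp_scale c x = of_int (to_int_mod_ring c) * x"

lemma vector_space_fp_scale:
  assumes "CARD('k::{field,finite}) = CARD('p::prime_card) ^ 2"
  shows "vector_space (fp_scale :: 'p mod_ring \<Rightarrow> 'k \<Rightarrow> 'k)"
proof -
  have pr: "prime CARD('p)" by (rule prime_card)
  have "CHAR('k) > 0" by (simp add: finite_imp_CHAR_pos)
  then have "prime CHAR('k)" by (rule prime_CHAR_semidom)
  moreover have "CHAR('k) dvd CARD('p) ^ 2" using CHAR_dvd_CARD[where 'a='k] assms by simp
  ultimately have ch: "CHAR('k) = CARD('p)"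
    using pr prime_dvd_power primes_dvd_imp_eq by blast
  have md: "(of_int (a mod int CARD('p)) :: 'k) = of_int a" for a
    unfolding ch[symmetric] by (simp add: of_int_eq_iff_cong_CHAR cong_def)
  have ad: "(of_int (to_int_mod_ring (a + b)) :: 'k)
      = of_int (to_int_mod_ring a) + of_int (to_int_mod_ring b)" for a b :: "'p mod_ring"
    by (metis md of_int_add plus_mod_ring.rep_eq to_int_mod_ring.rep_eq)
  have mu: "(of_int (to_int_mod_ring (a * b)) :: 'k)
      = of_int (to_int_mod_ring a) * of_int (to_int_mod_ring b)" for a b :: "'p mod_ring"
    by (metis md of_int_mult times_mod_ring.rep_eq to_int_mod_ring.rep_eq)
  show ?thesis
    by unfold_locales (simp_all add: fp_scale_def ad mu algebra_simps)
qed

definition fp_basis :: "'p::prime_card itself \<Rightarrow> 'k::field set \<Rightarrow> bool" where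
  "fp_basis _ B \<longleftrightarrow>
     \<not> Modules.module.dependent (fp_scale :: 'p mod_ring \<Rightarrow> 'k \<Rightarrow> 'k) B \<and>
     Modules.module.span (fp_scale :: 'p mod_ring \<Rightarrow> 'k \<Rightarrow> 'k) B = UNIV"

text \<open>When \<open>{1, \<omega>}\<close> is a basis, \<open>z\<close> is \<open>c + d\<omega>\<close> with \<open>c = coord_c \<omega> z\<close> and \<open>d = coord_d \<omega> z\<close>.\<close>

definition coord_c :: "'k::field \<Rightarrow> 'k \<Rightarrow> 'p::prime_card mod_ring" where
  "coord_c \<omega> z = Modules.module.representation fp_scale {1, \<omega>} z 1"

definition coord_d :: "'k::field \<Rightarrow> 'k \<Rightarrow> 'p::prime_card mod_ring" where
  "coord_d \<omega> z = Modules.module.representation fp_scale {1, \<omega>} z \<omega>"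

text \<open>Columns are indexed from 0, so columns \<open>2j\<close> and \<open>2j + 1\<close> come from entry \<open>j\<close> of \<open>v\<close>.\<close>

definition phi_O :: "'k::field \<Rightarrow> 'k vec \<Rightarrow> 'p::prime_card mod_ring mat" where
  "phi_O \<omega> v = mat 2 (2 * dim_vec v) (\<lambda>(a, b).
     let c = coord_c \<omega> (v $ (b div 2)); d = coord_d \<omega> (v $ (b div 2))
     in if a = 0 then (if even b then d else c)
        else (if even b then c + d else d))"

text \<open>Horizontal concatenation; the two lower blocks have no rows.\<close>

definition hcat :: "'a::zero mat \<Rightarrow> 'a mat \<Rightarrow> 'a mat" where
  "hcat A B = four_block_mat A B (0\<^sub>m 0 (dim_col A)) (0\<^sub>m 0 (dim_col B))"

definition code_D :: "'k::field \<Rightarrow> nat \<Rightarrow> nat \<Rightarrow> 'p::prime_card mod_ring vec set set" where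
  "code_D \<omega> r i =
     {row_sp (hcat (0\<^sub>m 2 (2 * r - 2 * i)) (hcat (1\<^sub>m 2) A)) | A. A \<in> phi_O \<omega> ` carrier_vec i}"

definition code_G :: "'k::field \<Rightarrow> nat \<Rightarrow> 'p::prime_card mod_ring vec set set" where
  "code_G \<omega> r =
     {row_sp (hcat (0\<^sub>m 2 (2 * r)) (1\<^sub>m 2))} \<union> (\<Union>i\<in>{1..r}. code_D \<omega> r i)"

end

theory Submission
  imports
    Defs
    "Berlekamp_Zassenhaus.Berlekamp_Type_Based"
    "HOL-Number_Theory.Quadratic_Reciprocity"
begin

text \<open>Every codeword is generated by a matrix \<open>(0 I\<^sub>2 \<phi>\<^sub>O(v))\<close> with \<open>v\<close> of length at most \<open>r\<close>; the
  codeword \<open>\<langle>(0 I\<^sub>2)\<rangle>\<close> belongs to \<open>v\<close> of length \<open>0\<close>. Distinct \<open>v\<close> give planes that meet trivially,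
  because the quadratic form \<open>a\<^sup>2 + a b - b\<^sup>2\<close> of discriminant \<open>5\<close> is anisotropic modulo
  \<open>p \<equiv> 2, 3 (mod 5)\<close> by quadratic reciprocity. So all distances are \<open>4\<close>, and there are
  \<open>1 + p\<^sup>2 + \<dots> + p\<^bsup>2r\<^esup>\<close> codewords.\<close>

section \<open>Row spaces of two-row matrices and their dimension\<close>

text \<open>Since \<open>sdim\<close> treats the span as a vector space of its own, \<open>S\<close>
  must be a basis inside it; linear independence there agrees with independence in the ambient
  space.\<close>

lemma (in vec_space) sdim_span:
  assumes "finite S" "S \<subseteq> carrier_vec n" "lin_indpt S"
  shows "sdim n (span S) = card S"
proof -
  have sub: "VectorSpace.subspace class_ring (span S) V"
    using span_is_subspace assms by simp
  then have sm: "submodule class_ring (span S) V"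
    by (simp add: subspace_def)
  have vs: "vectorspace class_ring (vs (span S))"
    by (rule subspace_is_vs[OF sub])
  interpret W: vectorspace class_ring "vs (span S)" by (rule vs)
  have SS: "S \<subseteq> span S" using assms in_own_span by simp
  have "W.basis S"
    unfolding W.basis_def
    using span_li_not_depend[OF SS sm] assms SS by simp
  then show ?thesis
    unfolding sdim_def using W.dim_basis assms(1) by simp
qed

lemma sdim_zero: "sdim n {0\<^sub>v n :: 'a::field vec} = 0"
proof -
  interpret vec_space "TYPE('a)" n .
  have "lin_indpt {}" by (rule finite_lin_indpt2) auto
  then show ?thesis using sdim_span[of "{}"] by (simp add: span_empty)
qed

text \<open>The row space is the image of the transpose, applied to vectors with two entries.
  Membership thus yields explicit coefficients \<open>a\<close> and \<open>b\<close>.\<close>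

lemma row_sp_2:
  fixes A :: "'a::field mat"
  assumes A: "A \<in> carrier_mat 2 n"
  shows "row_sp A = range (\<lambda>(a, b). vec n (\<lambda>j. a * A $$ (0, j) + b * A $$ (1, j)))"
proof -
  interpret vec_space "TYPE('a)" n .
  have eq: "A\<^sup>T *\<^sub>v y = vec n (\<lambda>j. y $ 0 * A $$ (0, j) + y $ 1 * A $$ (1, j))"
    if "y \<in> carrier_vec 2" for y
    using that A by (intro eq_vecI) (auto simp: scalar_prod_def numeral_2_eq_2)
  have "row_sp A = {w \<in> carrier_vec n. \<exists>y\<in>carrier_vec 2. A\<^sup>T *\<^sub>v y = w}"
    using A row_space_eq[OF A] by (simp add: row_sp_def)
  also have "\<dots> = range (\<lambda>(a, b). vec n (\<lambda>j. a * A $$ (0, j) + b * A $$ (1, j)))"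
  proof (intro equalityI subsetI)
    fix w assume "w \<in> range (\<lambda>(a, b). vec n (\<lambda>j. a * A $$ (0, j) + b * A $$ (1, j)))"
    then obtain a b where w: "w = vec n (\<lambda>j. a * A $$ (0, j) + b * A $$ (1, j))" by auto
    have "A\<^sup>T *\<^sub>v vec_of_list [a, b] = w"
      using eq[of "vec_of_list [a, b]"] w by (simp add: carrier_vecI)
    then show "w \<in> {w \<in> carrier_vec n. \<exists>y\<in>carrier_vec 2. A\<^sup>T *\<^sub>v y = w}"
      using w by (auto intro!: bexI[of _ "vec_of_list [a, b]"] carrier_vecI)
  qed (auto simp: eq)
  finally show ?thesis .
qed

lemma subspace_row_sp:
  fixes A :: "'a::field mat"
  assumes A: "A \<in> carrier_mat m n"
  shows "VectorSpace.subspace class_ring (row_sp A) (module_vec TYPE('a) n)"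
proof -
  interpret vec_space "TYPE('a)" n .
  have "set (rows A) \<subseteq> carrier V" using A by (auto simp: rows_def)
  then show ?thesis
    using A span_is_subspace by (simp add: row_sp_def row_space_def)
qed

lemma sdim_row_sp_2:
  fixes A :: "'a::field mat"
  assumes A: "A \<in> carrier_mat 2 n"
    and ind: "\<And>a b. (\<And>j. j < n \<Longrightarrow> a * A $$ (0, j) + b * A $$ (1, j) = 0) \<Longrightarrow> a = 0 \<and> b = 0"
  shows "sdim n (row_sp A) = 2"
proof -
  interpret vec_space "TYPE('a)" n .
  let ?u = "row A 0" and ?v = "row A 1"
  have rows: "set (rows A) = {?u, ?v}"
    using A by (auto simp: rows_def numeral_2_eq_2 less_Suc_eq image_iff)
  have uv: "?u \<in> carrier_vec n" "?v \<in> carrier_vec n" using A by auto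
  \<comment> \<open>Equal rows would collapse to a single element of the set; the coefficients 1 and
    -1 rule this out.\<close>
  have ne: "?u \<noteq> ?v"
  proof
    assume "?u = ?v"
    then have "A $$ (0, j) = A $$ (1, j)" if "j < n" for j
      using A that by (metis carrier_matD index_row(1) one_less_numeral_iff semiring_norm(76) zero_less_numeral)
    then have "(1::'a) = 0 \<and> (- 1::'a) = 0" by (intro ind) simp
    then show False by simp
  qed
  have "lin_indpt {?u, ?v}"
  proof (rule finite_lin_indpt2)
    fix c assume z: "lincomb c {?u, ?v} = 0\<^sub>v n"
    have "c ?u * A $$ (0, j) + c ?v * A $$ (1, j) = 0" if j: "j < n" for j
    proof -
      have "lincomb c {?u, ?v} $ j = c ?u * ?u $ j + c ?v * ?v $ j"
        using lincomb_index[OF j, of "{?u, ?v}" c] uv ne by simp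
      then show ?thesis using z A j by simp
    qed
    then have "c ?u = 0 \<and> c ?v = 0" by (rule ind)
    then show "\<forall>v\<in>{?u, ?v}. c v = 0" by simp
  qed (use uv in auto)
  then have "sdim n (span {?u, ?v}) = card {?u, ?v}"
    using uv by (intro sdim_span) auto
  moreover have "row_sp A = span {?u, ?v}"
    using A rows by (simp add: row_sp_def row_space_def)
  ultimately show ?thesis using ne by simp
qed

section \<open>Quadratic residues and the anisotropic form\<close>

text \<open>As 5 is 1 modulo 4, reciprocity carries no sign and would make \<open>p\<close> a square
  modulo 5, but those squares are 0, 1 and 4.\<close>

lemma five_not_QuadRes:
  assumes p: "prime p" "2 < p" and p5: "[p = 2] (mod 5) \<or> [p = 3] (mod 5)"
  shows "\<not> QuadRes (int p) 5"
proof
  assume "QuadRes (int p) 5"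
  have ne: "p \<noteq> 5" using p5 by (auto simp: cong_def)
  have "\<not> [5 = 0] (mod int p)"
  proof
    assume "[5 = 0] (mod int p)"
    then have "int p dvd int 5" by (simp add: cong_0_iff)
    then have "p dvd 5" by (simp only: int_dvd_int_iff)
    then show False using ne p primes_dvd_imp_eq[of p 5] by simp
  qed
  with \<open>QuadRes (int p) 5\<close> have L: "Legendre 5 (int p) = 1" by (simp add: Legendre_def)
  have "Legendre (int p) (int 5) * Legendre (int 5) (int p) = (-1) ^ ((p - 1) div 2 * ((5 - 1) div 2))"
    using p ne by (intro Quadratic_Reciprocity) auto
  then have "Legendre (int p) 5 = 1" using L by (simp add: power_mult mult.commute)
  then have "QuadRes 5 (int p)" by (auto simp: Legendre_def split: if_splits)
  then obtain y where y: "y ^ 2 mod 5 = int p mod 5" by (auto simp: QuadRes_def cong_def)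
  have "int p mod 5 = 2 \<or> int p mod 5 = 3" using p5 by (auto simp: cong_def) presburger+
  moreover have "y ^ 2 mod 5 = (y mod 5) ^ 2 mod 5" by (simp add: power_mod)
  moreover have "y mod 5 \<in> {0, 1, 2, 3, 4}" by auto
  ultimately show False using y by auto
qed

text \<open>In odd characteristic \<open>4 (a\<^sup>2 + a b - b\<^sup>2) = (2 a + b)\<^sup>2 - 5 b\<^sup>2\<close>.\<close>

lemma golden_form_anisotropic:
  fixes a b :: "'p::prime_card mod_ring"
  assumes p5: "[CARD('p) = 2] (mod 5) \<or> [CARD('p) = 3] (mod 5)"
    and z: "a * a + a * b - b * b = 0"
  shows "a = 0 \<and> b = 0"
proof (cases "b = 0")
  case True
  then show ?thesis using z by simp
next
  case False
  \<comment> \<open>Dehomogenizing: a zero of the form with \<open>b\<close> nonzero gives a root of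
    \<open>t * t + t - 1\<close>.\<close>
  define t where "t = a / b"
  have a: "a = t * b" using False by (simp add: t_def)
  have "(t * t + t - 1) * (b * b) = 0" using z by (simp add: a algebra_simps)
  then have t: "t * t + t - 1 = 0" using False by simp
  have pr: "prime CARD('p)" by (rule prime_card)
  \<comment> \<open>An integer lift of 2t + 1, because quadratic residues are stated for integers;
    completing the square makes its square congruent to 5.\<close>
  define y where "y = 2 * to_int_mod_ring t + 1"
  have tt: "of_int (to_int_mod_ring t) = t" by (simp add: of_int_of_int_mod_ring)
  show ?thesis
  proof (cases "CARD('p) = 2")
    case True
    have eo: "even k \<Longrightarrow> of_int k = (0 :: 'p mod_ring)" for k
      using of_int_eq_iff_cong_CHAR[where 'a = "'p mod_ring", of k 0] True
      by (simp add: cong_0_iff)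
    have "even (to_int_mod_ring t * to_int_mod_ring t + to_int_mod_ring t)" by simp
    from eo[OF this] have "t * t + t = 0" by (simp add: tt)
    then show ?thesis using t by simp
  next
    case False
    have "of_int (y ^ 2 - 5) = 4 * (t * t + t - 1)"
      by (simp add: y_def tt power2_eq_square algebra_simps)
    then have "of_int (y ^ 2) = (of_int 5 :: 'p mod_ring)" using t by simp
    then have "[y ^ 2 = 5] (mod int CARD('p))"
      by (simp only: of_int_eq_iff_cong_CHAR semiring_char_mod_ring)
    then have "QuadRes (int CARD('p)) 5" by (auto simp: QuadRes_def)
    moreover have "2 < CARD('p)" using False pr prime_ge_2_nat[OF pr] by simp
    ultimately show ?thesis using five_not_QuadRes[OF pr _ p5] by blast
  qed
qed

section \<open>Coordinates over the prime field and generator matrices\<close>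

lemma coord_inject:
  fixes \<omega> x y :: "'k::{field,finite}"
  assumes card: "CARD('k) = CARD('p::prime_card) ^ 2"
    and B: "fp_basis TYPE('p) {1, \<omega>}"
    and c: "(coord_c \<omega> x :: 'p mod_ring) = coord_c \<omega> y"
    and d: "(coord_d \<omega> x :: 'p mod_ring) = coord_d \<omega> y"
  shows "x = y"
proof -
  interpret vector_space "fp_scale :: 'p mod_ring \<Rightarrow> 'k \<Rightarrow> 'k"
    by (rule vector_space_fp_scale[OF card])
  have ind: "independent {1, \<omega>}" and sp: "span {1, \<omega>} = UNIV"
    using B by (auto simp: fp_basis_def)
  have "z = (\<Sum>b\<in>{1, \<omega>}. fp_scale (representation {1, \<omega>} z b) b)" for z
    using sum_representation_eq[OF ind, of z "{1, \<omega>}"] sp by simp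
  moreover have "representation {1, \<omega>} x b = representation {1, \<omega>} y b" if "b \<in> {1, \<omega>}" for b
    using that c d by (auto simp: coord_c_def coord_d_def)
  ultimately show ?thesis by (metis (no_types, lifting) sum.cong)
qed

text \<open>The number of leading zeros is read off from the length of \<open>v\<close>, so one map
  parametrizes all the codewords. The subtraction truncates for lengths above \<open>r\<close>,
  hence the bound on \<open>dim_vec v\<close> in later lemmas.\<close>

definition gen_mat :: "'k::field \<Rightarrow> nat \<Rightarrow> 'k vec \<Rightarrow> 'p::prime_card mod_ring mat" where
  "gen_mat \<omega> r v = hcat (0\<^sub>m 2 (2 * r - 2 * dim_vec v)) (hcat (1\<^sub>m 2) (phi_O \<omega> v))"

lemma gen_mat_carrier:
  "dim_vec v \<le> r \<Longrightarrow> (gen_mat \<omega> r v :: 'p::prime_card mod_ring mat) \<in> carrier_mat 2 (2 * r + 2)"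
  by (intro carrier_matI) (simp_all add: gen_mat_def hcat_def phi_O_def)

lemma gen_mat_index:
  fixes \<omega> :: "'k::field"
  assumes "dim_vec v \<le> r" "k < 2"
  shows "j < 2 * (r - dim_vec v) \<Longrightarrow> (gen_mat \<omega> r v :: 'p::prime_card mod_ring mat) $$ (k, j) = 0"
    and "l < 2 \<Longrightarrow> (gen_mat \<omega> r v :: 'p mod_ring mat) $$ (k, 2 * (r - dim_vec v) + l)
      = (if k = l then 1 else 0)"
    and "l < 2 * dim_vec v \<Longrightarrow> (gen_mat \<omega> r v :: 'p mod_ring mat) $$ (k, 2 * (r - dim_vec v) + 2 + l)
      = phi_O \<omega> v $$ (k, l)"
  using assms by (auto simp: gen_mat_def hcat_def phi_O_def diff_mult_distrib2)

lemma code_G_eq: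
  fixes \<omega> :: "'k::field"
  shows "(code_G \<omega> r :: 'p::prime_card mod_ring vec set set)
    = (\<lambda>v. row_sp (gen_mat \<omega> r v)) ` (\<Union>i\<le>r. carrier_vec i)"
proof -
  let ?f = "\<lambda>v. row_sp (gen_mat \<omega> r v :: 'p mod_ring mat)"
  have D: "code_D \<omega> r i = ?f ` carrier_vec i" for i
    by (auto simp: code_D_def gen_mat_def)
  have "hcat (0\<^sub>m 2 (2 * r)) (1\<^sub>m 2) = (gen_mat \<omega> r (0\<^sub>v 0) :: 'p mod_ring mat)"
    by (intro eq_matI) (auto simp: gen_mat_def hcat_def phi_O_def)
  \<comment> \<open>The empty vector is the only one of length 0, so the extra codeword supplies the
    index 0 missing from the union.\<close>
  moreover have "carrier_vec 0 = {0\<^sub>v 0 :: 'k vec}"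
    by (auto intro: eq_vecI)
  ultimately have H: "{row_sp (hcat (0\<^sub>m 2 (2 * r)) (1\<^sub>m 2))} = ?f ` carrier_vec 0"
    by (simp only: image_insert image_empty)
  have "(\<Union>i\<le>r. carrier_vec i) = carrier_vec 0 \<union> (\<Union>i\<in>{1..r}. carrier_vec i :: 'k vec set)"
    by (force simp: Suc_le_eq)
  then show ?thesis by (simp only: code_G_def D H image_Un image_UN)
qed

text \<open>If the two generators have different offsets, the leading block of the longer one shows that
  the common vector vanishes. Otherwise the two vectors have the same leading block \<open>(a, b)\<close>, and in
  every later block the difference \<open>(d, c)\<close> of the entries satisfies \<open>a d + b (c + d) = 0\<close> and
  \<open>a c + b d = 0\<close>, a linear system of determinant \<open>a\<^sup>2 + a b - b\<^sup>2\<close>.\<close>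

lemma gen_mat_common_vector:
  fixes \<omega> :: "'k::{field,finite}" and a b a' b' :: "'p::prime_card mod_ring"
  assumes p5: "[CARD('p) = 2] (mod 5) \<or> [CARD('p) = 3] (mod 5)"
    and card: "CARD('k) = CARD('p) ^ 2"
    and B: "fp_basis TYPE('p) {1, \<omega>}"
    and v: "dim_vec v \<le> r" and w: "dim_vec w \<le> r"
    and eq: "\<And>j. j < 2 * r + 2 \<Longrightarrow>
       a * gen_mat \<omega> r v $$ (0, j) + b * gen_mat \<omega> r v $$ (1, j)
       = a' * gen_mat \<omega> r w $$ (0, j) + b' * gen_mat \<omega> r w $$ (1, j)"
    and ne: "v \<noteq> w"
  shows "(a = 0 \<and> b = 0) \<or> (a' = 0 \<and> b' = 0)"
proof (cases "dim_vec v" "dim_vec w" rule: linorder_cases)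
  case less
  then show ?thesis
    using eq[of "2 * (r - dim_vec w)"] eq[of "2 * (r - dim_vec w) + 1"]
      gen_mat_index(1)[OF v, of _ "2 * (r - dim_vec w)" \<omega>, where 'p = 'p]
      gen_mat_index(1)[OF v, of _ "2 * (r - dim_vec w) + 1" \<omega>, where 'p = 'p]
      gen_mat_index(2)[OF w, of _ 0 \<omega>, where 'p = 'p]
      gen_mat_index(2)[OF w, of _ 1 \<omega>, where 'p = 'p] w
    by simp
next
  case greater
  then show ?thesis
    using eq[of "2 * (r - dim_vec v)"] eq[of "2 * (r - dim_vec v) + 1"]
      gen_mat_index(1)[OF w, of _ "2 * (r - dim_vec v)" \<omega>, where 'p = 'p]
      gen_mat_index(1)[OF w, of _ "2 * (r - dim_vec v) + 1" \<omega>, where 'p = 'p]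
      gen_mat_index(2)[OF v, of _ 0 \<omega>, where 'p = 'p]
      gen_mat_index(2)[OF v, of _ 1 \<omega>, where 'p = 'p] v
    by simp
next
  case equal
  \<comment> \<open>The identity blocks occupy the same columns, which equates the
    coefficients.\<close>
  have ab: "a' = a" "b' = b"
    using eq[of "2 * (r - dim_vec v)"] eq[of "2 * (r - dim_vec v) + 1"]
      gen_mat_index(2)[OF v, of _ 0 \<omega>, where 'p = 'p]
      gen_mat_index(2)[OF v, of _ 1 \<omega>, where 'p = 'p]
      gen_mat_index(2)[OF w, of _ 0 \<omega>, where 'p = 'p]
      gen_mat_index(2)[OF w, of _ 1 \<omega>, where 'p = 'p] v equal
    by simp_all
  have phi: "a * phi_O \<omega> v $$ (0, l) + b * phi_O \<omega> v $$ (1, l)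
      = a * phi_O \<omega> w $$ (0, l) + b * phi_O \<omega> w $$ (1, l)" if "l < 2 * dim_vec v" for l
    using eq[of "2 * (r - dim_vec v) + 2 + l"] that v equal
      gen_mat_index(3)[OF v, of _ l \<omega>, where 'p = 'p]
      gen_mat_index(3)[OF w, of _ l \<omega>, where 'p = 'p]
    by (simp add: ab)
  obtain m where m: "m < dim_vec v" "v $ m \<noteq> w $ m" using ne equal by auto
  define c where "c = (coord_c \<omega> (v $ m) - coord_c \<omega> (w $ m) :: 'p mod_ring)"
  define d where "d = (coord_d \<omega> (v $ m) - coord_d \<omega> (w $ m) :: 'p mod_ring)"
  have e1: "a * d + b * (c + d) = 0"
    using phi[of "2 * m"] m equal by (simp add: phi_O_def Let_def c_def d_def algebra_simps)
  have e2: "a * c + b * d = 0"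
    using phi[of "2 * m + 1"] m equal by (simp add: phi_O_def Let_def c_def d_def algebra_simps)
  \<comment> \<open>Cramer's rule: the adjugate of the system is applied to its two left-hand
    sides.\<close>
  have "(a * a + a * b - b * b) * d = a * (a * d + b * (c + d)) - b * (a * c + b * d)"
    "(a * a + a * b - b * b) * c = (a + b) * (a * c + b * d) - b * (a * d + b * (c + d))"
    by (simp_all add: algebra_simps)
  then have "a * a + a * b - b * b = 0 \<or> (c = 0 \<and> d = 0)" using e1 e2 by auto
  moreover have "\<not> (c = 0 \<and> d = 0)"
    using coord_inject[OF card B, of "v $ m" "w $ m"] m by (auto simp: c_def d_def)
  ultimately show ?thesis using golden_form_anisotropic[OF p5] by blast
qed

text \<open>The two columns of the identity block return \<open>a\<close> and
  \<open>b\<close>.\<close>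

lemma gen_mat_rows_independent:
  fixes a b :: "'p::prime_card mod_ring"
  assumes v: "dim_vec v \<le> r"
    and z: "\<And>j. j < 2 * r + 2 \<Longrightarrow> a * gen_mat \<omega> r v $$ (0, j) + b * gen_mat \<omega> r v $$ (1, j) = 0"
  shows "a = 0 \<and> b = 0"
  using z[of "2 * (r - dim_vec v)"] z[of "2 * (r - dim_vec v) + 1"] v
    gen_mat_index(2)[OF v, of _ 0 \<omega>, where 'p = 'p]
    gen_mat_index(2)[OF v, of _ 1 \<omega>, where 'p = 'p]
  by simp

section \<open>Counting the codewords and verifying the code parameters\<close>

lemma sum_even_powers:
  fixes p :: nat
  assumes "p \<ge> 2"
  shows "(\<Sum>i\<le>r. (p ^ 2) ^ i) = (p ^ (2 * r + 2) - 1) div (p ^ 2 - 1)"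
proof -
  have "p ^ 2 \<ge> 2 ^ 2" using assms by (intro power_mono) auto
  then have q: "p ^ 2 > 1" by simp
  have "(p ^ 2 - 1) * (\<Sum>i\<le>r. (p ^ 2) ^ i) = (p ^ 2) ^ Suc r - 1"
  proof -
    \<comment> \<open>Writing the base as \<open>Suc d\<close> keeps truncated subtraction out of
      the induction.\<close>
    obtain d where d: "p ^ 2 = Suc d" using q by (cases "p ^ 2") auto
    have "d * (\<Sum>i\<le>r. Suc d ^ i) + 1 = Suc d ^ Suc r"
      by (induction r) (simp_all add: algebra_simps)
    then show ?thesis by (simp add: d)
  qed
  also have "(p ^ 2) ^ Suc r = p ^ (2 * r + 2)" by (simp flip: power_mult power_add power_Suc)
  finally show ?thesis using q by (metis nonzero_mult_div_cancel_left zero_less_diff less_irrefl)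
qed

theorem mainTheorem3:
  fixes p r :: nat and \<omega> :: "'k::{field,finite}"
  assumes "prime p" and "p = CARD('p::prime_card)"
    and "[p = 2] (mod 5) \<or> [p = 3] (mod 5)"
    and "r > 0"
    and "CARD('k) = p ^ 2"
    and "fp_basis TYPE('p) {1, \<omega>}"
  shows "subspace_code p (2 * r + 2) ((p ^ (2 * r + 2) - 1) div (p ^ 2 - 1)) 4 2
           (code_G \<omega> r :: 'p mod_ring vec set set)"
proof -
  let ?I = "\<Union>i\<le>r. carrier_vec i :: 'k vec set"
  let ?n = "2 * r + 2"
  let ?g = "\<lambda>v. gen_mat \<omega> r v :: 'p mod_ring mat"
  let ?U = "\<lambda>v. row_sp (?g v)"
  have dim_le: "dim_vec v \<le> r" if "v \<in> ?I" for v using that by auto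
  have U: "VectorSpace.subspace class_ring (?U v) (module_vec TYPE('p mod_ring) ?n)"
    "sdim ?n (?U v) = 2" "0\<^sub>v ?n \<in> ?U v" if "v \<in> ?I" for v
  proof -
    note g = gen_mat_carrier[OF dim_le[OF that], of \<omega>, where 'p = 'p]
    show "VectorSpace.subspace class_ring (?U v) (module_vec TYPE('p mod_ring) ?n)"
      by (rule subspace_row_sp[OF g])
    show "sdim ?n (?U v) = 2"
      by (rule sdim_row_sp_2[OF g]) (rule gen_mat_rows_independent[OF dim_le[OF that]])
    show "0\<^sub>v ?n \<in> ?U v"
      unfolding row_sp_2[OF g] by (rule image_eqI[of _ _ "(0, 0)"]) auto
  qed
  have inter: "?U v \<inter> ?U w = {0\<^sub>v ?n}" if v: "v \<in> ?I" and w: "w \<in> ?I" and ne: "v \<noteq> w" for v w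
  proof -
    note gv = gen_mat_carrier[OF dim_le[OF v], of \<omega>, where 'p = 'p]
    note gw = gen_mat_carrier[OF dim_le[OF w], of \<omega>, where 'p = 'p]
    have "x = 0\<^sub>v ?n" if "x \<in> ?U v" "x \<in> ?U w" for x
    proof -
      from that(1) obtain a b where x: "x = vec ?n (\<lambda>j. a * ?g v $$ (0, j) + b * ?g v $$ (1, j))"
        unfolding row_sp_2[OF gv] by auto
      from that(2) obtain a' b' where x': "x = vec ?n (\<lambda>j. a' * ?g w $$ (0, j) + b' * ?g w $$ (1, j))"
        unfolding row_sp_2[OF gw] by auto
      have "a * ?g v $$ (0, j) + b * ?g v $$ (1, j) = a' * ?g w $$ (0, j) + b' * ?g w $$ (1, j)"
        if "j < ?n" for j
        using arg_cong[OF trans[OF x[symmetric] x'], of "\<lambda>y. y $ j"] that by simp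
      from gen_mat_common_vector[OF _ _ assms(6) dim_le[OF v] dim_le[OF w] this ne]
      have "(a = 0 \<and> b = 0) \<or> (a' = 0 \<and> b' = 0)" using assms(2,3,5) by blast
      then show ?thesis using x x' by (elim disjE) (auto simp: zero_vec_def)
    qed
    then show ?thesis using U(3)[OF v] U(3)[OF w] by blast
  qed
  have dist: "subspace_dist ?n (?U v) (?U w) = 4" if "v \<in> ?I" "w \<in> ?I" "v \<noteq> w" for v w
    using U(2)[OF that(1)] U(2)[OF that(2)] inter[OF that] by (simp add: subspace_dist_def sdim_zero)
  have inj: "inj_on ?U ?I"
  proof (rule inj_onI, rule ccontr)
    \<comment> \<open>Two different parameters with the same plane would make that plane its own
      trivial intersection, against dimension 2.\<close>
    fix v w assume vw: "v \<in> ?I" "w \<in> ?I" "?U v = ?U w" "v \<noteq> w"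
    then have "?U v = {0\<^sub>v ?n}" using inter[OF vw(1,2,4)] by simp
    then show False using U(2)[OF vw(1)] by (simp add: sdim_zero)
  qed
  \<comment> \<open>Vectors of different lengths are distinct, so the union is disjoint.\<close>
  have "card ?I = (\<Sum>i\<le>r. card (carrier_vec i :: 'k vec set))"
    by (rule card_UN_disjoint) (auto dest: carrier_vecD)
  also have "\<dots> = (p ^ ?n - 1) div (p ^ 2 - 1)"
    using sum_even_powers[OF prime_ge_2_nat[OF assms(1)]] by (simp add: card_carrier_vec assms(5))
  finally have "card (?U ` ?I) = (p ^ ?n - 1) div (p ^ 2 - 1)"
    by (simp add: card_image[OF inj])
  moreover have "finite (?U ` ?I)" by simp
  moreover have "\<exists>X\<in>?U ` ?I. \<exists>Y\<in>?U ` ?I. X \<noteq> Y \<and> subspace_dist ?n X Y = int 4"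
  proof -
    \<comment> \<open>The zero vectors of lengths 0 and \<open>r\<close> differ because
      \<open>r > 0\<close>; their codewords attain the minimum distance.\<close>
    have "dim_vec (0\<^sub>v 0 :: 'k vec) \<noteq> dim_vec (0\<^sub>v r :: 'k vec)" using assms(4) by simp
    then have "0\<^sub>v 0 \<noteq> (0\<^sub>v r :: 'k vec)" by metis
    moreover have "0\<^sub>v 0 \<in> ?I" "0\<^sub>v r \<in> ?I" by (auto intro: zero_carrier_vec)
    ultimately show ?thesis
      using dist[of "0\<^sub>v 0" "0\<^sub>v r"] inj_onD[OF inj, of "0\<^sub>v 0" "0\<^sub>v r"]
      by (intro bexI[of _ "?U (0\<^sub>v 0)"] bexI[of _ "?U (0\<^sub>v r)"] conjI notI imageI) simp_all
  qed
  moreover have "\<forall>X\<in>?U ` ?I. \<forall>Y\<in>?U ` ?I. X \<noteq> Y \<longrightarrow> int 4 \<le> subspace_dist ?n X Y"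
  proof (intro ballI impI)
    fix X Y assume "X \<in> ?U ` ?I" "Y \<in> ?U ` ?I" "X \<noteq> Y"
    then obtain v w where "v \<in> ?I" "w \<in> ?I" "v \<noteq> w" "X = ?U v" "Y = ?U w" by blast
    then show "int 4 \<le> subspace_dist ?n X Y" using dist[of v w] by simp
  qed
  moreover have "\<forall>X\<in>?U ` ?I. VectorSpace.subspace class_ring X (module_vec TYPE('p mod_ring) ?n)
      \<and> sdim ?n X = 2"
    using U by blast
  ultimately show ?thesis
    unfolding subspace_code_def code_G_eq using assms(2) by simp
qed

end
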